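(* Let $N_r\ge 2$ be an integer for which an $N_r\times N_r$ Hadamard matrix with all-one first row exists, let $\Theta\in\mathbb{R}$, and let $\mathbf v(\Theta)=[1,e^{\mathrm j\Theta},\dots,e^{\mathrm j(N_r-1)\Theta}]^T\in\mathbb{C}^{N_r}$. Consider the optimization problem $$\max_{\mathbf S}\ \operatorname{rank}(\mathbf S)\quad\text{subject to}\quad \mathbf S\,\mathbf v(\Theta)=\mathbf 0,\qquad |[\mathbf S]_{m,n}|=1\ \ \forall m,n,$$ over complex matrices $\mathbf S$ with $N_r$ columns and full row rank. Let $\bar{\mathbf H}$ be the $(N_r-1)\times N_r$ matrix obtained from such a Hadamard matrix by removing its first (all-one) row, and let $\mathbf R=\operatorname{diag}(1,e^{-\mathrm j\Theta},\dots,e^{-\mathrm j(N_r-1)\Theta})$. Then $$\mathbf S_H=\bar{\mathbf H}\mathbf R$$ is a solution (a maximizer) of this problem.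
   Context: $\mathrm j$ denotes the imaginary unit. A Hadamard matrix is a square matrix whose entries are all $+1$ or $-1$ and whose rows are mutually orthogonal. The number of rows of $\mathbf S$ is not fixed in advance: it equals its rank. *)

theory Defs
  imports Complex_Main "Jordan_Normal_Form.DL_Rank"
begin

definition hadamard_mat :: "real mat \<Rightarrow> bool" where
  "hadamard_mat H \<longleftrightarrow>
     square_mat H \<and>
     (\<forall>i < dim_row H. \<forall>j < dim_col H. H $$ (i, j) = 1 \<or> H $$ (i, j) = - 1) \<and>
     (\<forall>i < dim_row H. \<forall>k < dim_row H. i \<noteq> k \<longrightarrow> row H i \<bullet> row H k = 0)"

definition delete_first_row :: "'a mat \<Rightarrow> 'a mat" where
  "delete_first_row A = mat_of_rows (dim_col A) (tl (rows A))"

text \<open>The locale constant \<open>vec_space.rank\<close> takes the dimension of the ambient space of the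
  columns, i.e. the number of rows, as a parameter.\<close>

definition mat_rank :: "'a :: field mat \<Rightarrow> nat" where
  "mat_rank A = vec_space.rank (dim_row A) A"

definition steering_vec :: "nat \<Rightarrow> real \<Rightarrow> complex vec" where
  "steering_vec N \<Theta> = vec N (\<lambda>n. exp (\<i> * of_real (real n * \<Theta>)))"

definition phase_mat :: "nat \<Rightarrow> real \<Rightarrow> complex mat" where
  "phase_mat N \<Theta> = mat_diag N (\<lambda>n. exp (- \<i> * of_real (real n * \<Theta>)))"

text \<open>The number of rows is not a parameter: a feasible matrix may have any number of rows, subject
  to full row rank.\<close>

definition feasible :: "nat \<Rightarrow> real \<Rightarrow> complex mat \<Rightarrow> bool" where
  "feasible N \<Theta> S \<longleftrightarrow>
     dim_col S = N \<and>
     mat_rank S = dim_row S \<and>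
     S *\<^sub>v steering_vec N \<Theta> = 0\<^sub>v (dim_row S) \<and>
     (\<forall>m < dim_row S. \<forall>n < N. cmod (S $$ (m, n)) = 1)"

end

theory Submission
  imports Defs
begin

text \<open>The steering vector is a nonzero kernel vector of every feasible matrix, so no feasible rank
  reaches the number \<open>N\<close> of columns. The conjugate transpose of \<open>S\<^sub>H\<close> divided by \<open>N\<close> is a right inverse
  of \<open>S\<^sub>H\<close>, because the phases cancel and distinct Hadamard rows are orthogonal; hence \<open>S\<^sub>H\<close> has rank
  \<open>N - 1\<close>. Orthogonality to the deleted all-one row gives the kernel condition.\<close>

text \<open>A nonzero kernel vector is a linear dependence between columns, but
  \<open>lin_dep\<close> speaks of the set of columns and so yields this only when they are
  distinct. If a column repeats, the set has fewer than \<open>nc\<close> elements, which already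
  bounds the rank.\<close>

lemma (in vec_space) rank_lt_nc_if_kernel_nonzero:
  assumes A: "A \<in> carrier_mat n nc"
    and v: "v \<in> carrier_vec nc" "v \<noteq> 0\<^sub>v nc" "A *\<^sub>v v = 0\<^sub>v n"
  shows "rank A < nc"
proof (cases "distinct (cols A)")
  case True
  have "lin_dep (set (cols A))"
    using lin_depI[OF A v True] .
  then have "rank A \<noteq> nc"
    using full_rank_lin_indpt[OF A _ True] by blast
  then show ?thesis
    using rank_le_nc[OF A] by simp
next
  case False
  obtain U where U: "maximal U (\<lambda>T. T \<subseteq> set (cols A) \<and> lin_indpt T)"
    using maximal_exists_superset[of "set (cols A)" "\<lambda>T. T \<subseteq> set (cols A) \<and> lin_indpt T" "{}"]
    by (auto simp: finite_lin_indpt2)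
  have "rank A = card U"
    using rank_card_indpt[OF A U] .
  also have "\<dots> \<le> card (set (cols A))"
    using U by (auto simp: maximal_def intro: card_mono)
  also have "\<dots> < length (cols A)"
    using False card_distinct card_length le_neq_implies_less by blast
  finally show ?thesis
    using A by simp
qed

text \<open>Each \<open>w\<close> is the image under \<open>A\<close> of
  \<open>B *\<^sub>v w\<close>, and the images under \<open>A\<close> are exactly the span of its
  columns.\<close>

lemma (in vec_space) rank_eq_n_if_right_inverse:
  assumes A: "A \<in> carrier_mat n nc" and B: "B \<in> carrier_mat nc n"
    and AB: "A * B = 1\<^sub>m n"
  shows "rank A = n"
proof -
  have cA: "set (cols A) \<subseteq> carrier_vec n"
    using A cols_dim by blast
  have "w \<in> span (set (cols A))" if w: "w \<in> carrier_vec n" for w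
  proof -
    have "A *\<^sub>v (B *\<^sub>v w) = w"
      using assoc_mult_mat_vec[OF A B w] AB w by simp
    moreover have "B *\<^sub>v w \<in> carrier_vec nc"
      using B w by simp
    ultimately show ?thesis
      using col_space_eq[OF A] A w by (auto simp: col_space_def)
  qed
  then have "span (set (cols A)) = carrier_vec n"
    using span_closed[OF cA] by blast
  then show ?thesis
    using dim_is_n by (simp add: rank_def module_vec_def)
qed

lemma delete_first_row_carrier:
  assumes "A \<in> carrier_mat (Suc m) n"
  shows "delete_first_row A \<in> carrier_mat m n"
  using assms by (simp add: delete_first_row_def mat_of_rows_def)

lemma delete_first_row_index:
  assumes "A \<in> carrier_mat (Suc m) n" "i < m" "j < n"
  shows "delete_first_row A $$ (i, j) = A $$ (Suc i, j)"
  using assms by (simp add: delete_first_row_def mat_of_rows_def nth_tl)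

lemma mult_phase_mat_index:
  assumes "A \<in> carrier_mat m N" "i < m" "j < N"
  shows "(A * phase_mat N \<Theta>) $$ (i, j) = A $$ (i, j) * exp (- \<i> * of_real (real j * \<Theta>))"
  using assms unfolding phase_mat_def by (subst mat_diag_mult_right) auto

lemma feasible_mat_rank_less:
  assumes "feasible N \<Theta> S" "0 < N"
  shows "mat_rank S < N"
  unfolding mat_rank_def
proof (rule vec_space.rank_lt_nc_if_kernel_nonzero)
  show "S \<in> carrier_mat (dim_row S) N" "S *\<^sub>v steering_vec N \<Theta> = 0\<^sub>v (dim_row S)"
    using assms(1) by (auto simp: feasible_def)
  show "steering_vec N \<Theta> \<in> carrier_vec N"
    by (simp add: steering_vec_def)
  \<comment> \<open>The entry at index 0 is \<open>exp 0 = 1\<close> for every angle.\<close>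
  have "steering_vec N \<Theta> $ 0 \<noteq> 0\<^sub>v N $ 0"
    using assms(2) by (simp add: steering_vec_def)
  then show "steering_vec N \<Theta> \<noteq> 0\<^sub>v N"
    by metis
qed

text \<open>Entrywise form of \<open>H * H^T = N I\<close>: squared signs give the diagonal. It
  serves both the right inverse and the kernel condition.\<close>

lemma hadamard_row_products:
  assumes "hadamard_mat H" "H \<in> carrier_mat N N" "i < N" "k < N"
  shows "(\<Sum>j<N. H $$ (i, j) * H $$ (k, j)) = (if i = k then real N else 0)"
proof (cases "i = k")
  case True
  have "H $$ (i, j) * H $$ (k, j) = 1" if "j < N" for j
    using assms that True unfolding hadamard_mat_def by fastforce
  then show ?thesis
    using True by simp
next
  case False
  have "row H i \<bullet> row H k = 0"
    using assms False by (auto simp: hadamard_mat_def)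
  also have "row H i \<bullet> row H k = (\<Sum>j<N. H $$ (i, j) * H $$ (k, j))"
    using assms by (auto simp: scalar_prod_def lessThan_atLeast0 intro!: sum.cong)
  finally show ?thesis
    using False by simp
qed

theorem proposition2:
  fixes N\<^sub>r :: nat and \<Theta> :: real and H :: "real mat"
  assumes "N\<^sub>r \<ge> 2"
    and "hadamard_mat H"
    and "H \<in> carrier_mat N\<^sub>r N\<^sub>r"
    and "\<forall>n < N\<^sub>r. H $$ (0, n) = 1"
  shows "is_arg_max mat_rank (feasible N\<^sub>r \<Theta>)
           (map_mat complex_of_real (delete_first_row H) * phase_mat N\<^sub>r \<Theta>)"
proof -
  define S where "S = map_mat complex_of_real (delete_first_row H) * phase_mat N\<^sub>r \<Theta>"
  \<comment> \<open>\<open>m\<close> counts the rows left after the deletion, so row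
    \<open>i\<close> of \<open>S\<close> stems from row \<open>Suc i\<close> of
    \<open>H\<close>.\<close>
  obtain m where N: "N\<^sub>r = Suc m"
    using assms(1) by (cases N\<^sub>r) auto
  have H: "H \<in> carrier_mat (Suc m) N\<^sub>r"
    using assms(3) N by simp
  have D: "map_mat complex_of_real (delete_first_row H) \<in> carrier_mat m N\<^sub>r"
    using delete_first_row_carrier[OF H] by simp
  have S: "S \<in> carrier_mat m N\<^sub>r"
    using D by (simp add: S_def phase_mat_def)
  have S_index: "S $$ (i, j) = of_real (H $$ (Suc i, j)) * exp (- \<i> * of_real (real j * \<Theta>))"
    if "i < m" "j < N\<^sub>r" for i j
    using that delete_first_row_carrier[OF H]
    by (simp add: S_def mult_phase_mat_index[OF D] delete_first_row_index[OF H])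
  have phase_cancel: "exp (- \<i> * of_real (real j * \<Theta>)) * exp (\<i> * of_real (real j * \<Theta>)) = 1" for j
    by (simp add: exp_add[symmetric])

  \<comment> \<open>Since \<open>H\<close> is real, conjugation only flips the sign of the phase;
    dividing by \<open>N\<^sub>r\<close> normalizes the squared row norms.\<close>
  define B where "B = mat N\<^sub>r m
    (\<lambda>(j, k). of_real (H $$ (Suc k, j) / real N\<^sub>r) * exp (\<i> * of_real (real j * \<Theta>)))"
  have B: "B \<in> carrier_mat N\<^sub>r m"
    by (simp add: B_def)
  have "S * B = 1\<^sub>m m"
  proof (rule eq_matI)
    fix i k assume "i < dim_row (1\<^sub>m m :: complex mat)" "k < dim_col (1\<^sub>m m :: complex mat)"
    then have ik: "i < m" "k < m" by simp_all
    have "(S * B) $$ (i, k) = (\<Sum>j<N\<^sub>r. S $$ (i, j) * B $$ (j, k))"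
      using S B ik by (simp add: scalar_prod_def lessThan_atLeast0)
    also have "\<dots> = (\<Sum>j<N\<^sub>r. of_real (H $$ (Suc i, j) * H $$ (Suc k, j) / real N\<^sub>r) *
        (exp (- \<i> * of_real (real j * \<Theta>)) * exp (\<i> * of_real (real j * \<Theta>))))"
      using ik by (intro sum.cong refl) (simp add: S_index B_def)
    also have "\<dots> = of_real ((\<Sum>j<N\<^sub>r. H $$ (Suc i, j) * H $$ (Suc k, j)) / real N\<^sub>r)"
      by (simp only: phase_cancel) (simp add: sum_divide_distrib)
    \<comment> \<open>The sum up to \<open>Suc m\<close> must stay whole to match the row product,
      so the rules that split off its last term and expand \<open>real (Suc m)\<close> are
      removed.\<close>
    also have "\<dots> = 1\<^sub>m m $$ (i, k)"
      using ik assms(1) hadamard_row_products[OF assms(2,3), of "Suc i" "Suc k", unfolded N]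
      by (simp add: N del: sum.lessThan_Suc of_nat_Suc)
    finally show "(S * B) $$ (i, k) = 1\<^sub>m m $$ (i, k)" .
  qed (use S B in auto)
  then have rank_S: "mat_rank S = m"
    using vec_space.rank_eq_n_if_right_inverse[OF S B] S by (simp add: mat_rank_def)

  have "S *\<^sub>v steering_vec N\<^sub>r \<Theta> = 0\<^sub>v m"
  proof (rule eq_vecI)
    fix i assume "i < dim_vec (0\<^sub>v m :: complex vec)"
    then have i: "i < m" by simp
    have "(S *\<^sub>v steering_vec N\<^sub>r \<Theta>) $ i = (\<Sum>j<N\<^sub>r. S $$ (i, j) * steering_vec N\<^sub>r \<Theta> $ j)"
      using S i by (simp add: scalar_prod_def lessThan_atLeast0 steering_vec_def)
    \<comment> \<open>The factor \<open>H $$ (0, j) = 1\<close> is inserted so that the sum becomes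
      the product of the all-one row with row \<open>Suc i\<close>.\<close>
    also have "\<dots> = (\<Sum>j<N\<^sub>r. of_real (H $$ (0, j) * H $$ (Suc i, j)) *
        (exp (- \<i> * of_real (real j * \<Theta>)) * exp (\<i> * of_real (real j * \<Theta>))))"
      using i assms(4)
      by (intro sum.cong refl) (simp add: S_index steering_vec_def)
    also have "\<dots> = of_real (\<Sum>j<N\<^sub>r. H $$ (0, j) * H $$ (Suc i, j))"
      by (simp only: phase_cancel) simp
    also have "\<dots> = 0"
      using i N hadamard_row_products[OF assms(2,3), of 0 "Suc i"] by simp
    finally show "(S *\<^sub>v steering_vec N\<^sub>r \<Theta>) $ i = 0\<^sub>v m $ i"
      using i by simp
  qed (use S in auto)
  moreover have "cmod (S $$ (i, j)) = 1" if "i < m" "j < N\<^sub>r" for i j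
  proof -
    have "H $$ (Suc i, j) = 1 \<or> H $$ (Suc i, j) = - 1"
      using assms(2,3) that N by (auto simp: hadamard_mat_def)
    then have "cmod (of_real (H $$ (Suc i, j))) = 1"
      by auto
    moreover have "cmod (exp (- \<i> * of_real (real j * \<Theta>))) = 1"
      by (simp add: norm_exp_eq_Re)
    ultimately show ?thesis
      by (simp only: S_index[OF that] norm_mult mult_1)
  qed
  ultimately have "feasible N\<^sub>r \<Theta> S"
    using S rank_S unfolding feasible_def by (metis carrier_matD)
  \<comment> \<open>A rank below \<open>Suc m\<close> is at most \<open>m\<close>, whatever the
    number of rows of \<open>S'\<close>.\<close>
  moreover have "\<not> mat_rank S' > mat_rank S" if "feasible N\<^sub>r \<Theta> S'" for S'
    using feasible_mat_rank_less[OF that] N rank_S by simp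
  ultimately show ?thesis
    by (auto simp: is_arg_max_def S_def)
qed

end
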